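(* Let $\lambda$ be a partition and let $J\subset I\subset P_\lambda$ be ideals of $P_\lambda$. For each prime $p$ let $\phi(O_{p,I})$ denote the image of the orbit $O_{p,I}$ in $A_{p,I}/A_{p,J}$. Then $$\lim_{p\to\infty}\frac{|\phi(O_{p,I})|}{|A_{p,I}/A_{p,J}|}=1,$$ where $p$ runs over the prime numbers.
   Context: A partition is a non-increasing sequence $\lambda=(\lambda_1\geq\cdots\geq\lambda_l)$ of positive integers. For a prime $p$, $A_{p,\lambda}=\mathbf{Z}/p^{\lambda_1}\mathbf{Z}\oplus\cdots\oplus\mathbf{Z}/p^{\lambda_l}\mathbf{Z}$ and $G_{p,\lambda}$ is its automorphism group. Fundamental poset $P$: its elements are the symbols $(p^r,k)$ with integers $0\leq r<k$, where $(p^r,k)$ stands for the orbit of $p^r$ in $\mathbf{Z}/p^k\mathbf{Z}$ under automorphisms of $\mathbf{Z}/p^k\mathbf{Z}$, i.e. the set of elements $p^ru$ with $p\nmid u$. The partial order is: $(p^r,k)\geq(p^s,l)$ if and only if $r\leq s$ and $k-r\geq l-s$. Since the order depends only on the pairs $(r,k)$, the poset $P$ is regarded as independent of $p$ (identify $(p^r,k)$ with the pair $(r,k)$). $P_\lambda$ is the induced subposet consisting of the elements $(p^r,k)$ with $k=\lambda_i$ for some $i$; it too is independent of $p$. An ideal of a poset is a (possibly empty) down-closed subset. For $a=(a_1,\ldots,a_l)\in A_{p,\lambda}$, $I(a)$ is the ideal of $P$ generated by the orbits of the non-zero coordinates $a_i\in\mathbf{Z}/p^{\lambda_i}\mathbf{Z}$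 ($a_i=p^ru\neq0$ with $p\nmid u$ contributes $(p^r,\lambda_i)$), and $I_\lambda(a)=I(a)\cap P_\lambda$. For an ideal $I$ of $P_\lambda$: $A_{p,I}=\{a\in A_{p,\lambda}: I_\lambda(a)\subset I\}$, a subgroup of $A_{p,\lambda}$ invariant under $G_{p,\lambda}$; and $O_{p,I}=\{a\in A_{p,\lambda}: I_\lambda(a)=I\}$, which is the $G_{p,\lambda}$-orbit in $A_{p,\lambda}$ corresponding to $I$. *)

theory Defs
  imports
    "HOL-Algebra.Product_Groups"
    "HOL-Computational_Algebra.Primes"
    Complex_Main
begin

definition is_partition :: "nat list \<Rightarrow> bool" where
  "is_partition lam \<longleftrightarrow> sorted_wrt (\<ge>) lam \<and> (\<forall>k\<in>set lam. 0 < k)"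

text \<open>The finite abelian \<open>p\<close>-group of type \<open>lam\<close>: tuples are extensional functions on the index
  set \<open>{..<length lam}\<close>, and the class of an integer modulo \<open>p ^ k\<close> is represented by an integer in
  \<open>{0..<p ^ k}\<close>. The group operation is addition, written multiplicatively by the library.\<close>

definition abelian_p_group :: "nat \<Rightarrow> nat list \<Rightarrow> (nat \<Rightarrow> int) monoid" where
  "abelian_p_group p lam =
     product_group {..<length lam} (\<lambda>i. integer_mod_group (p ^ (lam ! i)))"

text \<open>The fundamental poset: the pair \<open>(r, k)\<close> stands for the orbit of \<open>p ^ r\<close> in the integers
  modulo \<open>p ^ k\<close>. On the poset the natural number subtractions below are never truncated.\<close>

definition fund_poset :: "(nat \<times> nat) set" where
  "fund_poset = {(r, k). r < k}"

definition fund_le :: "nat \<times> nat \<Rightarrow> nat \<times> nat \<Rightarrow> bool" where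
  "fund_le x y \<longleftrightarrow> (case x of (s, l) \<Rightarrow> case y of (r, k) \<Rightarrow> r \<le> s \<and> l - s \<le> k - r)"

definition fund_subposet :: "nat list \<Rightarrow> (nat \<times> nat) set" where
  "fund_subposet lam = {(r, k) \<in> fund_poset. k \<in> set lam}"

definition fund_ideal :: "(nat \<times> nat) set \<Rightarrow> (nat \<times> nat) set \<Rightarrow> bool" where
  "fund_ideal Q I \<longleftrightarrow> I \<subseteq> Q \<and> (\<forall>y\<in>I. \<forall>x\<in>Q. fund_le x y \<longrightarrow> x \<in> I)"

definition generated_ideal :: "(nat \<times> nat) set \<Rightarrow> (nat \<times> nat) set" where
  "generated_ideal S = {x \<in> fund_poset. \<exists>y\<in>S. fund_le x y}"

definition coordinate_orbits :: "nat \<Rightarrow> nat list \<Rightarrow> (nat \<Rightarrow> int) \<Rightarrow> (nat \<times> nat) set" where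
  "coordinate_orbits p lam a =
     {(r, lam ! i) | r i. i < length lam \<and> a i \<noteq> 0 \<and> (\<exists>u. a i = int p ^ r * u \<and> \<not> int p dvd u)}"

definition ideal_of :: "nat \<Rightarrow> nat list \<Rightarrow> (nat \<Rightarrow> int) \<Rightarrow> (nat \<times> nat) set" where
  "ideal_of p lam a = generated_ideal (coordinate_orbits p lam a)"

definition ideal_of_in :: "nat \<Rightarrow> nat list \<Rightarrow> (nat \<Rightarrow> int) \<Rightarrow> (nat \<times> nat) set" where
  "ideal_of_in p lam a = ideal_of p lam a \<inter> fund_subposet lam"

definition ideal_subgroup :: "nat \<Rightarrow> nat list \<Rightarrow> (nat \<times> nat) set \<Rightarrow> (nat \<Rightarrow> int) set" where
  "ideal_subgroup p lam I = {a \<in> carrier (abelian_p_group p lam). ideal_of_in p lam a \<subseteq> I}"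

definition ideal_orbit :: "nat \<Rightarrow> nat list \<Rightarrow> (nat \<times> nat) set \<Rightarrow> (nat \<Rightarrow> int) set" where
  "ideal_orbit p lam I = {a \<in> carrier (abelian_p_group p lam). ideal_of_in p lam a = I}"

definition ideal_quotient ::
  "nat \<Rightarrow> nat list \<Rightarrow> (nat \<times> nat) set \<Rightarrow> (nat \<times> nat) set \<Rightarrow> (nat \<Rightarrow> int) set monoid" where
  "ideal_quotient p lam I J =
     (abelian_p_group p lam)\<lparr>carrier := ideal_subgroup p lam I\<rparr> Mod ideal_subgroup p lam J"

definition quotient_image ::
  "nat \<Rightarrow> nat list \<Rightarrow> (nat \<times> nat) set \<Rightarrow> (nat \<times> nat) set \<Rightarrow> (nat \<Rightarrow> int) set set" where
  "quotient_image p lam I J =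
     (\<lambda>a. ideal_subgroup p lam J
            #>\<^bsub>(abelian_p_group p lam)\<lparr>carrier := ideal_subgroup p lam I\<rparr>\<^esub> a)
       ` ideal_orbit p lam I"

end

theory Submission
  imports Defs
begin

text \<open>An ideal \<open>I\<close> assigns to each part \<open>k\<close> the least exponent \<open>r\<close> with \<open>(r, k)\<close> in \<open>I\<close> (or \<open>k\<close>, if
  there is none), and the subgroup of \<open>I\<close> is the product of the subgroups generated by the
  corresponding powers \<open>p ^ r\<close>. A tuple whose coordinates have exactly these valuations lies in the
  orbit of \<open>I\<close>; among all tuples of the subgroup such tuples make up a fraction of at least
  \<open>(1 - 1 / p) ^ l\<close>, where \<open>l\<close> is the number of parts. A coset contains at most as many elements of
  the orbit as the smaller subgroup has elements, so the same bound holds in the quotient.\<close>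

section \<open>Counting by cosets\<close>

text \<open>The cosets of the elements of \<open>S\<close> cover \<open>S\<close>, and each has
  \<open>card H\<close> elements.\<close>

lemma (in group) card_le_card_image_r_coset:
  assumes "subgroup H G" and "finite H" and "finite S" and "S \<subseteq> carrier G"
  shows "card S \<le> card ((\<lambda>a. H #> a) ` S) * card H"
proof -
  have sub: "S \<subseteq> \<Union> ((\<lambda>a. H #> a) ` S)"
    using assms rcos_self by blast
  have card: "card R = card H \<and> finite R" if "R \<in> (\<lambda>a. H #> a) ` S" for R
  proof -
    have R: "R \<in> rcosets H"
      using that assms(4) by (auto simp: RCOSETS_def)
    then show ?thesis
      using card_rcosets_equal[OF R] rcosets_finite[OF R] subgroup.subset[OF assms(1)] assms(2)
      by auto
  qed
  have "card S \<le> card (\<Union> ((\<lambda>a. H #> a) ` S))"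
    using sub card assms(3) by (intro card_mono) auto
  also have "\<dots> \<le> (\<Sum>R\<in>(\<lambda>a. H #> a) ` S. card R)"
    using card by (intro card_Union_le_sum_card)
  also have "\<dots> = card ((\<lambda>a. H #> a) ` S) * card H"
    using card by simp
  finally show ?thesis .
qed

section \<open>Subgroups of the cyclic factors\<close>

definition multiples :: "nat \<Rightarrow> nat \<Rightarrow> nat \<Rightarrow> int set" where
  "multiples p k e = {x \<in> {0..<int p ^ k}. int p ^ e dvd x}"

lemma finite_multiples [simp]: "finite (multiples p k e)"
  unfolding multiples_def by (rule finite_subset[of _ "{0..<int p ^ k}"]) auto

lemma multiples_Suc_subset: "multiples p k (Suc e) \<subseteq> multiples p k e"
  unfolding multiples_def by (auto intro: dvd_trans[OF le_imp_power_dvd])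

text \<open>Multiplication by p^e is a bijection from \<open>{0..<int p ^ (k - e)}\<close> onto the
  set.\<close>

lemma card_multiples:
  assumes "0 < p" and "e \<le> k"
  shows "card (multiples p k e) = p ^ (k - e)"
proof -
  have eq: "int p ^ k = int p ^ e * int p ^ (k - e)"
    using assms by (simp flip: power_add)
  have pos: "0 < int p ^ e"
    using assms by simp
  have "x \<in> multiples p k e \<longleftrightarrow> (\<exists>y. x = int p ^ e * y \<and> y \<in> {0..<int p ^ (k - e)})" for x
    unfolding multiples_def eq dvd_def mem_Collect_eq atLeastLessThan_iff
    using mult_less_cancel_left_pos[OF pos] mult_le_cancel_left_pos[OF pos, of 0] by auto
  then have "multiples p k e = (\<lambda>x. int p ^ e * x) ` {0..<int p ^ (k - e)}"
    by blast
  moreover have "inj_on (\<lambda>x. int p ^ e * x) {0..<int p ^ (k - e)}"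
    using assms by (auto simp: inj_on_def)
  ultimately show ?thesis
    by (simp add: card_image nat_power_eq)
qed

text \<open>Reduction modulo p^k preserves divisibility by p^e, because p^e divides p^k.\<close>

lemma subgroup_multiples:
  assumes "0 < p" and "e \<le> k"
  shows "subgroup (multiples p k e) (integer_mod_group (p ^ k))"
proof (rule group.subgroupI)
  have dvd: "int p ^ e dvd int p ^ k"
    using assms by (simp add: le_imp_power_dvd)
  show "multiples p k e \<subseteq> carrier (integer_mod_group (p ^ k))"
    by (auto simp: multiples_def carrier_integer_mod_group)
  show "multiples p k e \<noteq> {}"
    using assms by (auto simp: multiples_def intro!: exI[of _ 0])
  fix a assume a: "a \<in> multiples p k e"
  then have "a \<in> carrier (integer_mod_group (p ^ k))"
    by (auto simp: multiples_def carrier_integer_mod_group)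
  with a show "inv\<^bsub>integer_mod_group (p ^ k)\<^esub> a \<in> multiples p k e"
    using assms dvd by (auto simp: multiples_def dvd_mod)
  fix b assume "b \<in> multiples p k e"
  with a show "a \<otimes>\<^bsub>integer_mod_group (p ^ k)\<^esub> b \<in> multiples p k e"
    using assms dvd by (auto simp: multiples_def dvd_mod)
qed simp

text \<open>For \<open>e < k\<close> these are the elements of valuation exactly \<open>e\<close>.
  At \<open>e = k\<close> the difference would be empty, so the only element 0 of the subgroup is
  kept instead.\<close>

definition multiples_exact :: "nat \<Rightarrow> nat \<Rightarrow> nat \<Rightarrow> int set" where
  "multiples_exact p k e = (if e < k then multiples p k e - multiples p k (Suc e) else {0})"

lemma finite_multiples_exact [simp]: "finite (multiples_exact p k e)"
  by (simp add: multiples_exact_def)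

text \<open>For \<open>e < k\<close> the removed subgroup has index p, so equality holds; for
  \<open>e = k\<close> both sets have one element.\<close>

lemma card_multiples_exact_ge:
  assumes "0 < p" and "e \<le> k"
  shows "real (card (multiples_exact p k e)) \<ge> (1 - 1 / real p) * real (card (multiples p k e))"
proof (cases "e < k")
  case True
  then obtain d where d: "k - e = Suc d" "k - Suc e = d"
    by (metis Suc_diff_Suc)
  have "real (card (multiples_exact p k e))
      = real (card (multiples p k e)) - real (card (multiples p k (Suc e)))"
    using True multiples_Suc_subset[of p k e]
    by (simp add: multiples_exact_def card_Diff_subset card_mono of_nat_diff)
  also have "\<dots> = (1 - 1 / real p) * real (card (multiples p k e))"
    using assms True d by (simp add: card_multiples field_simps)
  finally show ?thesis
    by simp
next
  case False
  then show ?thesis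
    using assms by (simp add: multiples_exact_def card_multiples)
qed

section \<open>Ideals described by exponents\<close>

text \<open>The alternative \<open>k \<le> r\<close> ensures that a least value exists and caps it
  at \<open>k\<close>.\<close>

definition ideal_exponent :: "(nat \<times> nat) set \<Rightarrow> nat \<Rightarrow> nat" where
  "ideal_exponent I k = (LEAST r. (r, k) \<in> I \<or> k \<le> r)"

lemma ideal_exponent_le: "ideal_exponent I k \<le> k"
  unfolding ideal_exponent_def by (rule Least_le) simp

text \<open>For fixed \<open>k\<close> a larger exponent gives a smaller element of the poset, so an
  ideal containing (r, k) contains every (s, k) with r \<le> s < k.\<close>

lemma mem_ideal_iff_ideal_exponent_le:
  assumes "fund_ideal (fund_subposet lam) I" and "k \<in> set lam" and "r < k"
  shows "(r, k) \<in> I \<longleftrightarrow> ideal_exponent I k \<le> r"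
proof
  show "ideal_exponent I k \<le> r" if "(r, k) \<in> I"
    unfolding ideal_exponent_def by (rule Least_le) (use that in simp)
  assume le: "ideal_exponent I k \<le> r"
  have "(ideal_exponent I k, k) \<in> I \<or> k \<le> ideal_exponent I k"
    unfolding ideal_exponent_def by (rule LeastI[of _ k]) simp
  \<comment> \<open>The least value is at most \<open>r\<close>, hence below \<open>k\<close>, which
    rules out the second alternative.\<close>
  with le assms(3) have "(ideal_exponent I k, k) \<in> I"
    by simp
  moreover have "(r, k) \<in> fund_subposet lam"
    using assms by (simp add: fund_subposet_def fund_poset_def)
  moreover have "fund_le (r, k) (ideal_exponent I k, k)"
    using le by (simp add: fund_le_def)
  ultimately show "(r, k) \<in> I"
    using assms(1) unfolding fund_ideal_def by blast
qed

section \<open>Valuations of coordinates\<close>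

text \<open>The decomposition of a nonzero integer into a power of p and a factor prime to p is
  unique, so each nonzero coordinate contributes one pair.\<close>

lemma coordinate_orbits_prime:
  assumes "prime p"
  shows "coordinate_orbits p lam a
    = {(multiplicity (int p) (a i), lam ! i) | i. i < length lam \<and> a i \<noteq> 0}"
proof -
  have "(\<exists>u. x = int p ^ r * u \<and> \<not> int p dvd u) \<longleftrightarrow> r = multiplicity (int p) x" if "x \<noteq> 0" for x r
  proof
    assume "\<exists>u. x = int p ^ r * u \<and> \<not> int p dvd u"
    with assms show "r = multiplicity (int p) x"
      by (metis multiplicity_decomposeI not_prime_0 of_nat_eq_0_iff)
  next
    assume "r = multiplicity (int p) x"
    with that assms show "\<exists>u. x = int p ^ r * u \<and> \<not> int p dvd u"
      by (metis multiplicity_decompose' not_prime_unit prime_nat_int_transfer)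
  qed
  then show ?thesis
    unfolding coordinate_orbits_def by blast
qed

lemma prime_power_dvd_iff_le_multiplicity:
  assumes "prime p" and "x \<noteq> 0"
  shows "int p ^ e dvd x \<longleftrightarrow> e \<le> multiplicity (int p) x"
  using assms by (intro power_dvd_iff_le_multiplicity) auto

lemma multiplicity_less_if_less_power:
  assumes "prime p" and "x \<in> {0..<int p ^ k}" and "x \<noteq> 0"
  shows "multiplicity (int p) x < k"
proof (rule ccontr)
  assume "\<not> multiplicity (int p) x < k"
  then have "int p ^ k dvd x"
    using assms by (simp add: prime_power_dvd_iff_le_multiplicity)
  then have "int p ^ k \<le> x"
    using assms by (intro zdvd_imp_le) auto
  with assms(2) show False
    by simp
qed

section \<open>Subgroups and orbits as products\<close>

lemma carrier_abelian_p_group: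
  assumes "0 < p"
  shows "carrier (abelian_p_group p lam) = (\<Pi>\<^sub>E i\<in>{..<length lam}. {0..<int p ^ (lam ! i)})"
  using assms by (simp add: abelian_p_group_def carrier_integer_mod_group)

lemma group_abelian_p_group: "group (abelian_p_group p lam)"
  by (simp add: abelian_p_group_def)

text \<open>Since \<open>I\<close> is down-closed, it contains the ideal of a tuple as soon as it
  contains the generators, and this bounds the valuation of each nonzero coordinate
  separately.\<close>

lemma ideal_subgroup_eq:
  assumes p: "prime p" and I: "fund_ideal (fund_subposet lam) I"
  shows "ideal_subgroup p lam I
    = (\<Pi>\<^sub>E i\<in>{..<length lam}. multiples p (lam ! i) (ideal_exponent I (lam ! i)))"
proof -
  have "ideal_of_in p lam a \<subseteq> I \<longleftrightarrow> (\<forall>i<length lam. int p ^ ideal_exponent I (lam ! i) dvd a i)"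
    if a: "\<And>i. i < length lam \<Longrightarrow> a i \<in> {0..<int p ^ (lam ! i)}" for a
  proof
    assume sub: "ideal_of_in p lam a \<subseteq> I"
    show "\<forall>i<length lam. int p ^ ideal_exponent I (lam ! i) dvd a i"
    proof (intro allI impI)
      fix i assume i: "i < length lam"
      show "int p ^ ideal_exponent I (lam ! i) dvd a i"
      \<comment> \<open>A zero coordinate has no orbit, but every power of p divides it.\<close>
      proof (cases "a i = 0")
        case False
        let ?x = "(multiplicity (int p) (a i), lam ! i)"
        have less: "multiplicity (int p) (a i) < lam ! i"
          by (rule multiplicity_less_if_less_power[OF p a[OF i] False])
        have "?x \<in> coordinate_orbits p lam a"
          using i False p by (auto simp: coordinate_orbits_prime)
        with less i have "?x \<in> ideal_of_in p lam a"
          by (auto simp: ideal_of_in_def ideal_of_def generated_ideal_def fund_subposet_def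
              fund_poset_def fund_le_def)
        with sub have "?x \<in> I"
          by blast
        with less i False p show ?thesis
          by (simp add: mem_ideal_iff_ideal_exponent_le[OF I] prime_power_dvd_iff_le_multiplicity)
      qed simp
    qed
  next
    assume dvd: "\<forall>i<length lam. int p ^ ideal_exponent I (lam ! i) dvd a i"
    show "ideal_of_in p lam a \<subseteq> I"
    proof
      fix x assume "x \<in> ideal_of_in p lam a"
      then obtain i where i: "i < length lam" "a i \<noteq> 0"
        and x: "fund_le x (multiplicity (int p) (a i), lam ! i)" "x \<in> fund_subposet lam"
        by (auto simp: ideal_of_in_def ideal_of_def generated_ideal_def coordinate_orbits_prime[OF p])
      have "int p ^ ideal_exponent I (lam ! i) dvd a i"
        using dvd i by blast
      then have "(multiplicity (int p) (a i), lam ! i) \<in> I"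
        using i p multiplicity_less_if_less_power[OF p a[OF i(1)] i(2)]
        by (simp add: mem_ideal_iff_ideal_exponent_le[OF I] prime_power_dvd_iff_le_multiplicity)
      with x I show "x \<in> I"
        unfolding fund_ideal_def by blast
    qed
  qed
  note iff = this
  have mem: "a \<in> ideal_subgroup p lam I \<longleftrightarrow>
      a \<in> (\<Pi>\<^sub>E i\<in>{..<length lam}. {0..<int p ^ (lam ! i)}) \<and>
      (\<forall>i<length lam. int p ^ ideal_exponent I (lam ! i) dvd a i)" for a
    \<comment> \<open>The equivalence holds for reduced coordinates only; the congruence rule
      supplies this from the first conjunct.\<close>
    unfolding ideal_subgroup_def carrier_abelian_p_group[OF prime_gt_0_nat[OF p]] mem_Collect_eq
    by (rule conj_cong[OF refl], rule iff) (simp add: PiE_iff)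
  show ?thesis
    by (auto simp: set_eq_iff mem PiE_iff multiples_def)
qed

text \<open>Each element of \<open>I\<close> with second entry k lies below the pair formed by the
  exponent of \<open>I\<close> at k and k itself, and here that pair is the orbit of a coordinate.
  The inclusion can be strict: a generator from one part may already dominate the pairs of
  another.\<close>

lemma multiples_exact_subset_ideal_orbit:
  assumes p: "prime p" and I: "fund_ideal (fund_subposet lam) I"
  shows "(\<Pi>\<^sub>E i\<in>{..<length lam}. multiples_exact p (lam ! i) (ideal_exponent I (lam ! i)))
    \<subseteq> ideal_orbit p lam I"
proof
  fix a assume a: "a \<in> (\<Pi>\<^sub>E i\<in>{..<length lam}. multiples_exact p (lam ! i) (ideal_exponent I (lam ! i)))"
  have "multiples_exact p k e \<subseteq> multiples p k e" for k e
    using p by (auto simp: multiples_exact_def multiples_def prime_gt_0_nat)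
  with a have "a \<in> ideal_subgroup p lam I"
    unfolding ideal_subgroup_eq[OF p I] by (auto simp: PiE_iff)
  then have carrier: "a \<in> carrier (abelian_p_group p lam)" and sub: "ideal_of_in p lam a \<subseteq> I"
    by (auto simp: ideal_subgroup_def)
  have "I \<subseteq> ideal_of_in p lam a"
  proof
    fix x assume x: "x \<in> I"
    then have "x \<in> fund_subposet lam"
      using I by (auto simp: fund_ideal_def)
    then obtain r i where ri: "x = (r, lam ! i)" "r < lam ! i" "i < length lam"
      by (auto simp: fund_subposet_def fund_poset_def in_set_conv_nth)
    let ?e = "ideal_exponent I (lam ! i)"
    have e: "?e \<le> r"
      using mem_ideal_iff_ideal_exponent_le[OF I] ri x by simp
    \<comment> \<open>As \<open>?e \<le> r < lam ! i\<close>, the default \<open>{0}\<close> does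
      not apply; 0 itself lies in both sets and so is excluded.\<close>
    then have ai: "a i \<in> multiples p (lam ! i) ?e - multiples p (lam ! i) (Suc ?e)"
      using a ri by (auto simp: PiE_iff multiples_exact_def split: if_splits)
    then have nz: "a i \<noteq> 0"
      by (auto simp: multiples_def)
    have "int p ^ ?e dvd a i" "\<not> int p ^ Suc ?e dvd a i"
      using ai by (auto simp: multiples_def)
    then have "multiplicity (int p) (a i) = ?e"
      unfolding prime_power_dvd_iff_le_multiplicity[OF p nz] by simp
    then have "(?e, lam ! i) \<in> coordinate_orbits p lam a"
      using ri nz by (force simp: coordinate_orbits_prime[OF p])
    moreover have "fund_le x (?e, lam ! i)"
      using e ri by (simp add: fund_le_def)
    ultimately show "x \<in> ideal_of_in p lam a"
      using \<open>x \<in> fund_subposet lam\<close>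
      by (auto simp: ideal_of_in_def ideal_of_def generated_ideal_def fund_subposet_def)
  qed
  with sub carrier show "a \<in> ideal_orbit p lam I"
    by (simp add: ideal_orbit_def)
qed

lemma subgroup_ideal_subgroup:
  assumes "prime p" and "fund_ideal (fund_subposet lam) I"
  shows "subgroup (ideal_subgroup p lam I) (abelian_p_group p lam)"
  using assms
  by (simp add: ideal_subgroup_eq abelian_p_group_def PiE_subgroup_product_group subgroup_multiples
      prime_gt_0_nat ideal_exponent_le)

lemma finite_ideal_subgroup:
  assumes "prime p" and "fund_ideal (fund_subposet lam) I"
  shows "finite (ideal_subgroup p lam I)"
  using assms by (simp add: ideal_subgroup_eq finite_PiE)

lemma ideal_orbit_subset: "ideal_orbit p lam I \<subseteq> ideal_subgroup p lam I"
  by (auto simp: ideal_orbit_def ideal_subgroup_def)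

section \<open>Density of the orbit, and passage to the quotient\<close>

lemma card_ideal_orbit_ge:
  assumes p: "prime p" and I: "fund_ideal (fund_subposet lam) I"
  shows "(1 - 1 / real p) ^ length lam * real (card (ideal_subgroup p lam I))
    \<le> real (card (ideal_orbit p lam I))"
proof -
  let ?e = "\<lambda>i. ideal_exponent I (lam ! i)"
  \<comment> \<open>This makes \<open>1 - 1 / real p\<close> nonnegative, as monotonicity of
    products requires.\<close>
  have p1: "1 \<le> real p"
    using prime_ge_1_nat[OF p] by simp
  have "(1 - 1 / real p) ^ length lam * real (card (ideal_subgroup p lam I))
      = (\<Prod>i<length lam. (1 - 1 / real p) * real (card (multiples p (lam ! i) (?e i))))"
    by (simp add: ideal_subgroup_eq[OF p I] card_PiE prod.distrib)
  also have "\<dots> \<le> (\<Prod>i<length lam. real (card (multiples_exact p (lam ! i) (?e i))))"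
    using p1 by (intro prod_mono conjI card_multiples_exact_ge ideal_exponent_le) auto
  also have "\<dots> = real (card (\<Pi>\<^sub>E i\<in>{..<length lam}. multiples_exact p (lam ! i) (?e i)))"
    by (simp add: card_PiE)
  also have "\<dots> \<le> real (card (ideal_orbit p lam I))"
    using multiples_exact_subset_ideal_orbit[OF p I]
      finite_subset[OF ideal_orbit_subset finite_ideal_subgroup[OF p I]]
    by (simp add: card_mono)
  finally show ?thesis .
qed

text \<open>The image is a set of cosets, whence the upper bound. The lower bound divides the
  estimate for the orbit by the size of the smaller subgroup.\<close>

lemma quotient_image_ratio_bounds:
  assumes p: "prime p" and I: "fund_ideal (fund_subposet lam) I"
    and J: "fund_ideal (fund_subposet lam) J" and "J \<subseteq> I"
  defines "ratio \<equiv> real (card (quotient_image p lam I J)) / real (order (ideal_quotient p lam I J))"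
  shows "(1 - 1 / real p) ^ length lam \<le> ratio" and "ratio \<le> 1"
proof -
  let ?G = "(abelian_p_group p lam)\<lparr>carrier := ideal_subgroup p lam I\<rparr>"
  let ?H = "ideal_subgroup p lam J"
  let ?q = "card (quotient_image p lam I J)"
  let ?o = "order (ideal_quotient p lam I J)"
  interpret A: group "abelian_p_group p lam"
    by (rule group_abelian_p_group)
  interpret G: group ?G
    using subgroup.subgroup_is_group[OF subgroup_ideal_subgroup[OF p I] A.is_group] .
  have "?H \<subseteq> ideal_subgroup p lam I"
    using \<open>J \<subseteq> I\<close> by (auto simp: ideal_subgroup_def)
  then have H: "subgroup ?H ?G"
    using A.subgroup_incl subgroup_ideal_subgroup[OF p] I J by blast
  have finH: "finite ?H" and fin: "finite (ideal_subgroup p lam I)"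
    using finite_ideal_subgroup p I J by auto
  have Hpos: "0 < card ?H"
    using finH subgroup.one_closed[OF H] by (auto simp: card_gt_0_iff)
  have order: "?o = card (rcosets\<^bsub>?G\<^esub> ?H)"
    by (simp add: order_def ideal_quotient_def FactGroup_def)
  have lagrange: "?o * card ?H = card (ideal_subgroup p lam I)"
    unfolding order using G.lagrange[OF H] by (simp add: order_def)
  have Ipos: "0 < card (ideal_subgroup p lam I)"
    using fin subgroup.one_closed[OF subgroup_ideal_subgroup[OF p I]] by (auto simp: card_gt_0_iff)
  have opos: "0 < ?o"
    using lagrange Ipos by (metis mult_0 neq0_conv)
  have "quotient_image p lam I J \<subseteq> rcosets\<^bsub>?G\<^esub> ?H"
    using ideal_orbit_subset by (force simp: quotient_image_def RCOSETS_def)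
  moreover have "finite (rcosets\<^bsub>?G\<^esub> ?H)"
    using fin by (simp add: RCOSETS_def)
  ultimately show "ratio \<le> 1"
    using opos by (simp add: ratio_def order card_mono)
  have "card (ideal_orbit p lam I) \<le> ?q * card ?H"
    unfolding quotient_image_def
    by (rule G.card_le_card_image_r_coset[OF H finH])
      (use finite_subset[OF ideal_orbit_subset fin] ideal_orbit_subset in auto)
  then have "real (card (ideal_orbit p lam I)) \<le> real ?q * real (card ?H)"
    by (metis of_nat_le_iff of_nat_mult)
  \<comment> \<open>Lagrange writes the size of the larger subgroup as \<open>?o * card ?H\<close>,
    so the positive factor \<open>card ?H\<close> cancels.\<close>
  with card_ideal_orbit_ge[OF p I]
  have "(1 - 1 / real p) ^ length lam * (real ?o * real (card ?H)) \<le> real ?q * real (card ?H)"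
    by (simp flip: lagrange)
  then have "(1 - 1 / real p) ^ length lam * real ?o \<le> real ?q"
    using Hpos by (simp flip: mult.assoc)
  then show "(1 - 1 / real p) ^ length lam \<le> ratio"
    using opos by (simp add: ratio_def field_simps)
qed

theorem theorem10p1:
  fixes lam :: "nat list" and I J :: "(nat \<times> nat) set"
  assumes "is_partition lam"
    and "fund_ideal (fund_subposet lam) I"
    and "fund_ideal (fund_subposet lam) J"
    and "J \<subseteq> I"
  shows "((\<lambda>p. real (card (quotient_image p lam I J)) / real (order (ideal_quotient p lam I J)))
           \<longlongrightarrow> 1) (inf at_top (principal {p::nat. prime p}))"
proof (rule tendsto_sandwich)
  let ?F = "inf at_top (principal {p::nat. prime p})"
  show "\<forall>\<^sub>F p in ?F. (1 - 1 / real p) ^ length lam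
      \<le> real (card (quotient_image p lam I J)) / real (order (ideal_quotient p lam I J))"
    using quotient_image_ratio_bounds(1)[OF _ assms(2-4)] by (simp add: eventually_inf_principal)
  show "\<forall>\<^sub>F p in ?F. real (card (quotient_image p lam I J))
      / real (order (ideal_quotient p lam I J)) \<le> 1"
    using quotient_image_ratio_bounds(2)[OF _ assms(2-4)] by (simp add: eventually_inf_principal)
  \<comment> \<open>The exponent does not depend on p, so the bound tends to 1 over all naturals,
    hence also along the finer filter of primes.\<close>
  have "(\<lambda>p. (1 - 1 / real p) ^ length lam) \<longlonglongrightarrow> (1 - 0) ^ length lam"
    by (intro tendsto_power tendsto_diff tendsto_const lim_1_over_n)
  then show "((\<lambda>p. (1 - 1 / real p) ^ length lam) \<longlongrightarrow> 1) ?F"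
    by (intro tendsto_mono[OF inf_le1]) simp
qed simp

end
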